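(* Let $\Gamma=(V,E)$ be a distance-regular graph of degree $k$ with intersection array $A$, and let $S$ be a set of $(s+1)$-cliques of $\Gamma$ such that every edge lies in exactly $m$ cliques of $S$. Let $T=(T_0,T_1)$ be a pair of disjoint nonempty independent sets of vertices of $\Gamma$, let $f^T$ be the function equal to $(-1)^i$ on $T_i$ ($i\in\{0,1\}$) and $0$ elsewhere, and let $\Gamma^T$ be the subgraph induced by $T_0\cup T_1$. The following are equivalent: (a') $T$ is an $S$-bitrade meeting the w.d. bound; (b') $f^T$ is an eigenfunction of $\Gamma$ with eigenvalue $-k/s$ meeting the w.d. bound; (c') $\Gamma^T$ is a regular isometric subgraph of $\Gamma$ of degree $k/s$.
   Context: An eigenfunction of $\Gamma$ with eigenvalue $\theta$ is a non-identically-zero $f:V\to\mathbb{R}$ with $\sum_{y\in\Gamma_1(x)}f(y)=\theta f(x)$ for all $x$. An $S$-bitrade is a pair of disjoint nonempty vertex sets $(T_0,T_1)$ such that every clique of $S$ meets each of $T_0,T_1$ in exactly one vertex or meets neither. Let $\Gamma$ have diameter $\mathrm{D}$ and intersection numbers $b_i,c_i$, $a_i=k-b_i-c_i$ (so $|\Gamma_{i+1}(x)\cap\Gamma_1(y)|=b_i$, $|\Gamma_{i-1}(x)\cap\Gamma_1(y)|=c_i$ whenever $y\in\Gamma_i(x)$). For an eigenvalue $\theta$ define $W^0_{A,\theta}=1$, $W^1_{A,\theta}=\theta$, $W^i_{A,\theta}=((\theta-a_{i-1})W^{i-1}_{A,\theta}-b_{i-2}W^{i-2}_{A,\theta})/c_i$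 for $i\ge2$. An eigenfunction with eigenvalue $\theta$ meets the w.d. (weight-distribution) bound if it has exactly $\sum_{i=0}^{\mathrm{D}}|W^i_{A,\theta}|$ nonzeros; a bitrade $T$ meets the w.d. bound if $f^T$ does (with $\theta=-k/s$). A subgraph is isometric if the distance between any two of its vertices in the subgraph equals their distance in $\Gamma$. *)

theory Defs
  imports Complex_Main "HOL-Library.Extended_Nat"
begin

text \<open>A graph is given by its vertex set and its set of edges, an edge being a two-element set of
  vertices.\<close>

definition simple_graph :: "'a set \<Rightarrow> 'a set set \<Rightarrow> bool" where
  "simple_graph V E \<longleftrightarrow> finite V \<and> (\<forall>e\<in>E. e \<subseteq> V \<and> card e = 2)"

definition induced_edges :: "'a set set \<Rightarrow> 'a set \<Rightarrow> 'a set set" where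
  "induced_edges E U = {e \<in> E. e \<subseteq> U}"

definition adjacency :: "'a set set \<Rightarrow> 'a rel" where
  "adjacency E = {(x, y). {x, y} \<in> E}"

text \<open>The \<open>n\<close>-th relational power of adjacency relates the ends of the walks of length \<open>n\<close>, so
  the distance is \<open>\<infinity>\<close> between vertices of different components.\<close>

definition graph_dist :: "'a set set \<Rightarrow> 'a \<Rightarrow> 'a \<Rightarrow> enat" where
  "graph_dist E x y = (INF n \<in> {n. (x, y) \<in> adjacency E ^^ n}. enat n)"

definition graph_sphere :: "'a set \<Rightarrow> 'a set set \<Rightarrow> nat \<Rightarrow> 'a \<Rightarrow> 'a set" where
  "graph_sphere V E i x = {y \<in> V. graph_dist E x y = enat i}"

definition connected_graph :: "'a set \<Rightarrow> 'a set set \<Rightarrow> bool" where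
  "connected_graph V E \<longleftrightarrow> (\<forall>x\<in>V. \<forall>y\<in>V. graph_dist E x y \<noteq> \<infinity>)"

definition graph_diameter :: "'a set \<Rightarrow> 'a set set \<Rightarrow> enat" where
  "graph_diameter V E = (SUP x\<in>V. SUP y\<in>V. graph_dist E x y)"

text \<open>The degree is a real number because it will be compared with a quotient \<open>k / s\<close> that need
  not be an integer.\<close>

definition regular_graph :: "'a set \<Rightarrow> 'a set set \<Rightarrow> real \<Rightarrow> bool" where
  "regular_graph V E d \<longleftrightarrow> (\<forall>x\<in>V. real (card {y \<in> V. {x, y} \<in> E}) = d)"

text \<open>For \<open>i = 0\<close> the truncated \<open>i - 1\<close> is harmless: then \<open>x = y\<close> and the second intersection is
  empty, as for the sphere of radius \<open>-1\<close>. The entries of \<open>b\<close> and \<open>c\<close> beyond the diameter are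
  unconstrained.\<close>

definition distance_regular :: "'a set \<Rightarrow> 'a set set \<Rightarrow> (nat \<Rightarrow> nat) \<Rightarrow> (nat \<Rightarrow> nat) \<Rightarrow> bool" where
  "distance_regular V E b c \<longleftrightarrow> simple_graph V E \<and> connected_graph V E \<and>
    (\<forall>i. \<forall>x\<in>V. \<forall>y \<in> graph_sphere V E i x.
       card (graph_sphere V E (i + 1) x \<inter> graph_sphere V E 1 y) = b i \<and>
       card (graph_sphere V E (i - 1) x \<inter> graph_sphere V E 1 y) = c i)"

definition is_clique :: "'a set \<Rightarrow> 'a set set \<Rightarrow> 'a set \<Rightarrow> bool" where
  "is_clique V E C \<longleftrightarrow> C \<subseteq> V \<and> (\<forall>x\<in>C. \<forall>y\<in>C. x \<noteq> y \<longrightarrow> {x, y} \<in> E)"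

definition independent_vertices :: "'a set \<Rightarrow> 'a set set \<Rightarrow> 'a set \<Rightarrow> bool" where
  "independent_vertices V E U \<longleftrightarrow> U \<subseteq> V \<and> (\<forall>x\<in>U. \<forall>y\<in>U. {x, y} \<notin> E)"

definition isometric_subgraph :: "'a set set \<Rightarrow> 'a set \<Rightarrow> 'a set set \<Rightarrow> bool" where
  "isometric_subgraph E U F \<longleftrightarrow> (\<forall>x\<in>U. \<forall>y\<in>U. graph_dist F x y = graph_dist E x y)"

definition eigenfunction :: "'a set \<Rightarrow> 'a set set \<Rightarrow> real \<Rightarrow> ('a \<Rightarrow> real) \<Rightarrow> bool" where
  "eigenfunction V E \<theta> f \<longleftrightarrow> (\<exists>x\<in>V. f x \<noteq> 0) \<and>
    (\<forall>x\<in>V. (\<Sum>y \<in> graph_sphere V E 1 x. f y) = \<theta> * f x)"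

definition bitrade :: "'a set \<Rightarrow> 'a set set \<Rightarrow> 'a set \<Rightarrow> 'a set \<Rightarrow> bool" where
  "bitrade V S T0 T1 \<longleftrightarrow> T0 \<subseteq> V \<and> T1 \<subseteq> V \<and> T0 \<noteq> {} \<and> T1 \<noteq> {} \<and> T0 \<inter> T1 = {} \<and>
    (\<forall>C\<in>S. (card (C \<inter> T0) = 1 \<and> card (C \<inter> T1) = 1) \<or> (C \<inter> T0 = {} \<and> C \<inter> T1 = {}))"

definition bitrade_fun :: "'a set \<Rightarrow> 'a set \<Rightarrow> 'a \<Rightarrow> real" where
  "bitrade_fun T0 T1 x = (if x \<in> T0 then 1 else if x \<in> T1 then -1 else 0)"

text \<open>Here \<open>real k - real (b i) - real (c i)\<close> is the intersection number \<open>a\<^sub>i\<close>.\<close>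

fun wd_coeff :: "nat \<Rightarrow> (nat \<Rightarrow> nat) \<Rightarrow> (nat \<Rightarrow> nat) \<Rightarrow> real \<Rightarrow> nat \<Rightarrow> real" where
  "wd_coeff k b c \<theta> 0 = 1"
| "wd_coeff k b c \<theta> (Suc 0) = \<theta>"
| "wd_coeff k b c \<theta> (Suc (Suc i)) =
     ((\<theta> - (real k - real (b (Suc i)) - real (c (Suc i)))) * wd_coeff k b c \<theta> (Suc i)
       - real (b i) * wd_coeff k b c \<theta> i) / real (c (Suc (Suc i)))"

text \<open>This is the cardinality condition alone; that \<open>f\<close> is an eigenfunction is not part of it.\<close>

definition meets_wd_bound ::
  "'a set \<Rightarrow> nat \<Rightarrow> nat \<Rightarrow> (nat \<Rightarrow> nat) \<Rightarrow> (nat \<Rightarrow> nat) \<Rightarrow> real \<Rightarrow> ('a \<Rightarrow> real) \<Rightarrow> bool" where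
  "meets_wd_bound V D k b c \<theta> f \<longleftrightarrow>
    real (card {x \<in> V. f x \<noteq> 0}) = (\<Sum>i=0..D. \<bar>wd_coeff k b c \<theta> i\<bar>)"

end

theory Submission
  imports Defs
begin

text \<open>The sum over \<open>C \<in> S\<close> of the squared clique sums of a function \<open>f\<close> is a multiple of
  \<open>\<langle>f, (A + k / s) f\<rangle>\<close>, so \<open>f\<close> is a \<open>-k / s\<close> eigenfunction iff it sums to zero over each
  clique, which for \<open>f\<^sup>T\<close> is the bitrade condition; moreover the eigenvalue equation needs to be
  checked only on the support of \<open>f\<close>. The sum of an eigenfunction over the sphere of radius \<open>i\<close>
  around \<open>x\<close> is \<open>W\<^sup>i f(x)\<close>. Hence \<open>f\<^sup>T\<close> meets the bound iff it does not change sign on any sphere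
  around a fixed vertex of \<open>T\<close>. As \<open>\<Gamma>\<^sup>T\<close> is bipartite, this holds if \<open>\<Gamma>\<^sup>T\<close> is isometric;
  conversely, a clique through the last edge of a geodesic of \<open>\<Gamma>\<close> from \<open>x\<close> to \<open>y\<close>, both in \<open>T\<close>,
  contains a neighbour of \<open>y\<close> in \<open>T\<close> that is closer to \<open>x\<close>, so geodesics can be chosen inside \<open>T\<close>.\<close>

section \<open>Distances and shortest walks\<close>

lemma graph_dist_le: "(x, y) \<in> adjacency E ^^ n \<Longrightarrow> graph_dist E x y \<le> enat n"
  unfolding graph_dist_def by (rule INF_lower) simp

text \<open>A finite infimum comes from a nonempty set of lengths, since the infimum of the empty
  set is \<open>\<infinity>\<close>; a nonempty set of naturals attains its infimum.\<close>

lemma walk_of_graph_dist: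
  assumes "graph_dist E x y = enat n"
  shows "(x, y) \<in> adjacency E ^^ n"
proof -
  let ?N = "enat ` {n. (x, y) \<in> adjacency E ^^ n}"
  have Inf: "graph_dist E x y = Inf ?N" by (simp add: graph_dist_def)
  then have "?N \<noteq> {}" using assms by (metis Inf_enat_def enat.distinct(1))
  then have "Inf ?N \<in> ?N"
    by (metis Inf_enat_def LeastI ex_in_conv)
  then show ?thesis using assms Inf by auto
qed

lemma graph_dist_antimono:
  assumes "F \<subseteq> E"
  shows "graph_dist E x y \<le> graph_dist F x y"
proof -
  have "adjacency F ^^ n \<subseteq> adjacency E ^^ n" for n
    using assms by (induction n) (auto simp: adjacency_def)
  then show ?thesis
    unfolding graph_dist_def by (intro INF_superset_mono) auto
qed

lemma graph_dist_eq_0_iff [simp]: "graph_dist E x y = 0 \<longleftrightarrow> x = y"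
proof
  assume "graph_dist E x y = 0"
  then show "x = y" using walk_of_graph_dist[of E x y 0] by (simp add: zero_enat_def)
next
  assume "x = y"
  then show "graph_dist E x y = 0"
    using graph_dist_le[of x y 0 E] by (simp add: zero_enat_def[symmetric])
qed

lemma graph_dist_step:
  assumes "{y, z} \<in> E" "graph_dist E x y = enat n"
  shows "graph_dist E x z \<le> enat (Suc n)"
  using assms walk_of_graph_dist[OF assms(2)]
  by (intro graph_dist_le relpow_Suc_I[of _ y]) (auto simp: adjacency_def)

text \<open>The last vertex before \<open>y\<close> on a shortest walk works: were it at distance
  less than \<open>n\<close>, one more step would reach \<open>y\<close> too early.\<close>

lemma graph_dist_pred:
  assumes "graph_dist E x y = enat (Suc n)"
  obtains z where "graph_dist E x z = enat n" "{z, y} \<in> E"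
proof -
  obtain z where z: "(x, z) \<in> adjacency E ^^ n" "(z, y) \<in> adjacency E"
    using walk_of_graph_dist[OF assms] by (auto elim: relpow_Suc_E)
  then have zy: "{z, y} \<in> E" and le: "graph_dist E x z \<le> enat n"
    by (auto simp: adjacency_def intro: graph_dist_le)
  then obtain j where j: "graph_dist E x z = enat j" "j \<le> n"
    by (cases "graph_dist E x z") auto
  have "j = n" using graph_dist_step[OF zy j(1)] assms j(2) by simp
  with j zy that show ?thesis by blast
qed

section \<open>Signed counting on the two parts\<close>

lemma sum_bitrade_fun:
  assumes "finite A" "T0 \<inter> T1 = {}"
  shows "(\<Sum>x\<in>A. bitrade_fun T0 T1 x) = real (card (A \<inter> T0)) - real (card (A \<inter> T1))"
proof -
  have "(\<Sum>x\<in>A. bitrade_fun T0 T1 x) =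
      (\<Sum>x\<in>A. (if x \<in> T0 then 1 else 0) - (if x \<in> T1 then 1 else 0))"
    using assms(2) by (intro sum.cong) (auto simp: bitrade_fun_def)
  then show ?thesis
    using assms(1) by (simp add: sum_subtractf sum.If_cases)
qed

lemma bitrade_fun_eq_0_iff: "bitrade_fun T0 T1 x = 0 \<longleftrightarrow> x \<notin> T0 \<union> T1"
  by (simp add: bitrade_fun_def)

section \<open>Spheres and diameter of a connected regular graph\<close>

locale regular_connected_graph =
  fixes V :: "'a set" and E :: "'a set set" and k :: nat
  assumes simple: "simple_graph V E"
    and connected: "connected_graph V E"
    and regular: "regular_graph V E (real k)"
begin

lemma finite_V [simp]: "finite V"
  using simple by (simp add: simple_graph_def)

lemma edge_in_V: "{x, y} \<in> E \<Longrightarrow> x \<in> V \<and> y \<in> V \<and> x \<noteq> y"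
  using simple by (cases "x = y") (auto simp: simple_graph_def)

lemma finite_sphere [simp]: "finite (graph_sphere V E i x)"
  by (simp add: graph_sphere_def)

lemma sphere_0: "x \<in> V \<Longrightarrow> graph_sphere V E 0 x = {x}"
  by (auto simp: graph_sphere_def simp flip: zero_enat_def)

lemma graph_dist_eq_1_iff: "graph_dist E x y = enat 1 \<longleftrightarrow> {x, y} \<in> E"
proof
  assume "graph_dist E x y = enat 1"
  then show "{x, y} \<in> E" using walk_of_graph_dist[of E x y 1] by (simp add: adjacency_def)
next
  assume e: "{x, y} \<in> E"
  then have "graph_dist E x y \<le> enat 1"
    by (intro graph_dist_le) (simp add: adjacency_def)
  moreover have "graph_dist E x y \<noteq> 0" using edge_in_V[OF e] by simp
  ultimately show "graph_dist E x y = enat 1"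
    by (cases "graph_dist E x y") (auto simp: zero_enat_def)
qed

lemma mem_sphere_1_iff: "y \<in> graph_sphere V E 1 x \<longleftrightarrow> {x, y} \<in> E"
  using edge_in_V[of x y] graph_dist_eq_1_iff[of x y] by (auto simp: graph_sphere_def)

lemma card_sphere_1: "x \<in> V \<Longrightarrow> card (graph_sphere V E 1 x) = k"
proof -
  assume "x \<in> V"
  moreover have "graph_sphere V E 1 x = {y \<in> V. {x, y} \<in> E}"
    using mem_sphere_1_iff[of _ x] by (auto dest: edge_in_V)
  ultimately show ?thesis using regular by (simp add: regular_graph_def)
qed

lemma finite_dist:
  assumes "x \<in> V" "y \<in> V"
  obtains n where "graph_dist E x y = enat n"
  using connected assms by (auto simp: connected_graph_def)

lemma graph_dist_le_diameter:
  assumes "x \<in> V" "y \<in> V"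
  shows "graph_dist E x y \<le> graph_diameter V E"
  unfolding graph_diameter_def using assms by (meson SUP_upper SUP_upper2)

text \<open>By connectedness and the bound \<open>D\<close> on all distances, the spheres of radius
  \<open>0\<close> to \<open>D\<close> around \<open>x\<close> partition \<open>V\<close>.\<close>

lemma sum_spheres:
  fixes g :: "'a \<Rightarrow> 'b::comm_monoid_add"
  assumes "x \<in> V" "graph_diameter V E = enat D"
  shows "(\<Sum>i=0..D. \<Sum>y\<in>graph_sphere V E i x. g y) = (\<Sum>y\<in>V. g y)"
proof -
  have "V = (\<Union>i\<in>{0..D}. graph_sphere V E i x)"
  proof (intro equalityI subsetI)
    fix y assume y: "y \<in> V"
    obtain n where n: "graph_dist E x y = enat n" using finite_dist[OF assms(1) y] .
    from graph_dist_le_diameter[OF assms(1) y] n y assms(2) show "y \<in> (\<Union>i\<in>{0..D}. graph_sphere V E i x)"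
      by (auto simp: graph_sphere_def)
  qed (auto simp: graph_sphere_def)
  moreover have "(\<Sum>y\<in>(\<Union>i\<in>{0..D}. graph_sphere V E i x). g y) =
      (\<Sum>i=0..D. \<Sum>y\<in>graph_sphere V E i x. g y)"
    by (intro sum.UNION_disjoint) (auto simp: graph_sphere_def)
  ultimately show ?thesis by simp
qed

text \<open>Only finitely many distances occur, so their supremum is a maximum.\<close>

lemma diameter_attained:
  assumes "V \<noteq> {}" "graph_diameter V E = enat D"
  obtains x y where "x \<in> V" "y \<in> V" "graph_dist E x y = enat D"
proof -
  define Z where "Z = (\<Union>x\<in>V. graph_dist E x ` V)"
  have "graph_diameter V E = Sup Z"
    using SUP_UNION[of "\<lambda>z. z" "\<lambda>x. graph_dist E x ` V" V]
    by (simp add: graph_diameter_def Z_def)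
  moreover have "finite Z" "Z \<noteq> {}" using assms(1) by (auto simp: Z_def)
  ultimately have "enat D \<in> Z"
    using assms(2) Max_in[of Z] by (simp add: Sup_enat_def)
  with that show ?thesis by (auto simp: Z_def)
qed

text \<open>Walking back from \<open>y\<close> along a geodesic to \<open>x\<close> meets every
  smaller radius.\<close>

lemma sphere_nonempty:
  assumes "x \<in> V" "y \<in> V" "graph_dist E x y = enat n" "i \<le> n"
  shows "graph_sphere V E i x \<noteq> {}"
  using assms
proof (induction "n - i" arbitrary: y n)
  case 0
  then show ?case by (auto simp: graph_sphere_def)
next
  case (Suc d)
  then obtain n' where n': "n = Suc n'" by (cases n) auto
  then obtain z where z: "graph_dist E x z = enat n'" "{z, y} \<in> E"
    using graph_dist_pred Suc.prems(3) by metis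
  show ?case
    using Suc.hyps Suc.prems n' z edge_in_V[OF z(2)] by (intro Suc.hyps(1)[of n' z]) auto
qed

end

section \<open>Sphere sums of eigenfunctions of a distance-regular graph\<close>

locale dist_regular_graph = regular_connected_graph +
  fixes b c :: "nat \<Rightarrow> nat"
  assumes dist_regular: "distance_regular V E b c"
begin

lemma card_sphere_up:
  "\<lbrakk>x \<in> V; y \<in> graph_sphere V E i x\<rbrakk> \<Longrightarrow>
    card (graph_sphere V E (Suc i) x \<inter> graph_sphere V E 1 y) = b i"
  using dist_regular by (auto simp: distance_regular_def)

lemma card_sphere_down:
  "\<lbrakk>x \<in> V; y \<in> graph_sphere V E (Suc i) x\<rbrakk> \<Longrightarrow>
    card (graph_sphere V E i x \<inter> graph_sphere V E 1 y) = c (Suc i)"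
  using dist_regular by (fastforce simp: distance_regular_def)

lemma neighbour_dist:
  assumes "y \<in> graph_sphere V E i x" "z \<in> graph_sphere V E j x" "{y, z} \<in> E"
  shows "i \<le> Suc j" "j \<le> Suc i"
  using graph_dist_step[of y z E x i] graph_dist_step[of z y E x j] assms
  by (auto simp: graph_sphere_def insert_commute)

text \<open>The \<open>k\<close> neighbours of \<open>y\<close> lie at distance \<open>i\<close>,
  \<open>i + 1\<close> or \<open>i + 2\<close> from \<open>x\<close>; removing those counted by
  \<open>c\<close> and \<open>b\<close> leaves the intersection number a of index
  \<open>i + 1\<close>.\<close>

lemma card_sphere_same:
  assumes "x \<in> V" "y \<in> graph_sphere V E (Suc i) x"
  shows "real (card (graph_sphere V E (Suc i) x \<inter> graph_sphere V E 1 y)) =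
    real k - real (b (Suc i)) - real (c (Suc i))"
proof -
  let ?S = "\<lambda>j. graph_sphere V E j x \<inter> graph_sphere V E 1 y"
  have "graph_sphere V E 1 y = ?S i \<union> (?S (Suc i) \<union> ?S (Suc (Suc i)))"
  proof (intro equalityI subsetI)
    fix z assume z: "z \<in> graph_sphere V E 1 y"
    then have e: "{y, z} \<in> E" by (simp only: mem_sphere_1_iff)
    then have "z \<in> V" using edge_in_V by blast
    then obtain j where j: "z \<in> graph_sphere V E j x"
      using finite_dist[OF assms(1)] by (auto simp: graph_sphere_def)
    from neighbour_dist[OF assms(2) j e] have "j = i \<or> j = Suc i \<or> j = Suc (Suc i)" by auto
    with z j show "z \<in> ?S i \<union> (?S (Suc i) \<union> ?S (Suc (Suc i)))" by auto
  qed auto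
  then have "k = card (?S i \<union> (?S (Suc i) \<union> ?S (Suc (Suc i))))"
    using card_sphere_1[of y] assms(2) by (simp add: graph_sphere_def)
  also have "\<dots> = card (?S i) + (card (?S (Suc i)) + card (?S (Suc (Suc i))))"
    by (subst card_Un_disjoint; (subst card_Un_disjoint)?) (auto simp: graph_sphere_def)
  finally show ?thesis
    using card_sphere_up[OF assms] card_sphere_down[OF assms] by simp
qed

text \<open>Makes the division in \<open>wd_coeff\<close> genuine up to the diameter. An end of a
  diametral pair has a nonempty sphere of radius \<open>i + 1\<close>, and a geodesic to a point of
  it supplies a neighbour one step closer.\<close>

lemma c_pos:
  assumes "V \<noteq> {}" "graph_diameter V E = enat D" "Suc i \<le> D"
  shows "c (Suc i) > 0"
proof -
  obtain x y where xy: "x \<in> V" "y \<in> V" "graph_dist E x y = enat D"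
    using diameter_attained[OF assms(1,2)] .
  then obtain z where z: "z \<in> graph_sphere V E (Suc i) x"
    using sphere_nonempty assms(3) by blast
  then have "graph_dist E x z = enat (Suc i)" by (simp add: graph_sphere_def)
  then obtain w where w: "graph_dist E x w = enat i" "{w, z} \<in> E"
    by (rule graph_dist_pred)
  then have "w \<in> graph_sphere V E i x \<inter> graph_sphere V E 1 z"
    using edge_in_V[OF w(2)] mem_sphere_1_iff[of w z]
    by (auto simp: graph_sphere_def insert_commute)
  then show ?thesis
    using card_sphere_down[OF xy(1) z] by (metis card_gt_0_iff empty_iff finite_Int finite_sphere)
qed

text \<open>Sum the eigenvalue equation over the sphere of radius \<open>i + 1\<close> and exchange
  the sums: \<open>f z\<close> occurs once per neighbour of \<open>z\<close> on that sphere. This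
  number is given by the intersection array when \<open>z\<close> is at distance \<open>i\<close>,
  \<open>i + 1\<close> or \<open>i + 2\<close>, and is zero otherwise.\<close>

lemma sphere_sum_recurrence:
  fixes f :: "'a \<Rightarrow> real"
  assumes "eigenfunction V E \<theta> f" "x \<in> V"
  defines "F \<equiv> \<lambda>i. \<Sum>y\<in>graph_sphere V E i x. f y"
  shows "\<theta> * F (Suc i) = real (b i) * F i
    + (real k - real (b (Suc i)) - real (c (Suc i))) * F (Suc i)
    + real (c (Suc (Suc i))) * F (Suc (Suc i))"
proof -
  let ?S = "\<lambda>j. graph_sphere V E j x"
  let ?n = "\<lambda>z. real (card (?S (Suc i) \<inter> graph_sphere V E 1 z))"
  have adj_sym: "y \<in> graph_sphere V E 1 z \<longleftrightarrow> z \<in> graph_sphere V E 1 y" for y z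
    by (simp only: mem_sphere_1_iff insert_commute)
  have "\<theta> * F (Suc i) = (\<Sum>y\<in>?S (Suc i). \<theta> * f y)"
    by (simp add: F_def sum_distrib_left)
  also have "\<dots> = (\<Sum>y\<in>?S (Suc i). \<Sum>z\<in>graph_sphere V E 1 y. f z)"
    using assms(1) by (intro sum.cong) (auto simp: eigenfunction_def graph_sphere_def)
  also have "\<dots> = (\<Sum>y\<in>?S (Suc i). \<Sum>z | z \<in> V \<and> z \<in> graph_sphere V E 1 y. f z)"
    by (intro sum.cong) (auto simp: graph_sphere_def)
  also have "\<dots> = (\<Sum>z\<in>V. \<Sum>y | y \<in> ?S (Suc i) \<and> z \<in> graph_sphere V E 1 y. f z)"
    by (rule sum.swap_restrict) auto
  also have "\<dots> = (\<Sum>z\<in>V. ?n z * f z)"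
    by (simp add: adj_sym[unfolded One_nat_def] Int_def)
  also have "\<dots> = (\<Sum>z\<in>?S i \<union> (?S (Suc i) \<union> ?S (Suc (Suc i))). ?n z * f z)"
  proof (intro sum.mono_neutral_right ballI)
    fix z assume z: "z \<in> V - (?S i \<union> (?S (Suc i) \<union> ?S (Suc (Suc i))))"
    then obtain j where j: "z \<in> ?S j"
      using finite_dist[OF assms(2)] by (auto simp: graph_sphere_def)
    have "?S (Suc i) \<inter> graph_sphere V E 1 z = {}"
    proof (rule ccontr)
      assume "?S (Suc i) \<inter> graph_sphere V E 1 z \<noteq> {}"
      then obtain y where y: "y \<in> ?S (Suc i)" "y \<in> graph_sphere V E 1 z" by blast
      from y(2) have "{z, y} \<in> E" by (simp only: mem_sphere_1_iff)
      from neighbour_dist[OF j y(1) this] have "j = i \<or> j = Suc i \<or> j = Suc (Suc i)" by auto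
      with z j show False by auto
    qed
    then show "?n z * f z = 0" by simp
  qed (auto simp: graph_sphere_def)
  also have "\<dots> = (\<Sum>z\<in>?S i. ?n z * f z)
      + ((\<Sum>z\<in>?S (Suc i). ?n z * f z) + (\<Sum>z\<in>?S (Suc (Suc i)). ?n z * f z))"
    by (subst sum.union_disjoint; (subst sum.union_disjoint)?) (auto simp: graph_sphere_def)
  also have "(\<Sum>z\<in>?S i. ?n z * f z) = real (b i) * F i"
    unfolding F_def sum_distrib_left
    by (intro sum.cong refl) (simp only: card_sphere_up[OF assms(2)])
  also have "(\<Sum>z\<in>?S (Suc i). ?n z * f z) =
      (real k - real (b (Suc i)) - real (c (Suc i))) * F (Suc i)"
    unfolding F_def sum_distrib_left
    by (intro sum.cong refl) (simp only: card_sphere_same[OF assms(2)])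
  also have "(\<Sum>z\<in>?S (Suc (Suc i)). ?n z * f z) = real (c (Suc (Suc i))) * F (Suc (Suc i))"
    unfolding F_def sum_distrib_left
    by (intro sum.cong refl) (simp only: card_sphere_down[OF assms(2)])
  finally show ?thesis by simp
qed

lemma sphere_sum:
  assumes "eigenfunction V E \<theta> f" "x \<in> V" "graph_diameter V E = enat D" "i \<le> D"
  shows "(\<Sum>y\<in>graph_sphere V E i x. f y) = wd_coeff k b c \<theta> i * f x"
  using assms(4)
proof (induction i rule: induct_nat_012)
  case 0
  then show ?case by (simp add: sphere_0 assms(2))
next
  case 1
  then show ?case using assms(1,2) by (simp add: eigenfunction_def)
next
  case (ge2 i)
  have "V \<noteq> {}" using assms(2) by blast
  then have "c (Suc (Suc i)) > 0" using c_pos assms(3) ge2.prems by blast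
  then show ?case
    using sphere_sum_recurrence[OF assms(1,2), of i] ge2.IH ge2.prems
    by (simp add: field_simps)
qed

end

section \<open>Clique sums and the eigenvalue equation\<close>

locale clique_system = regular_connected_graph +
  fixes S :: "'a set set" and s m :: nat
  assumes clique: "C \<in> S \<Longrightarrow> is_clique V E C \<and> card C = s + 1"
    and card_cliques_edge: "e \<in> E \<Longrightarrow> card {C \<in> S. e \<subseteq> C} = m"
    and s_pos: "s > 0" and m_pos: "m > 0"
begin

lemma clique_subset_V: "C \<in> S \<Longrightarrow> C \<subseteq> V"
  using clique by (simp add: is_clique_def)

lemma finite_S [simp]: "finite S"
  by (rule finite_subset[of _ "Pow V"]) (use clique_subset_V in auto)

text \<open>After exchanging the sums, \<open>f y\<close> is weighted by the number of cliques
  containing both \<open>x\<close> and \<open>y\<close>: \<open>m\<close> for neighbours, and none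
  for other vertices \<open>y\<close> distinct from \<open>x\<close>.\<close>

lemma sum_cliques_through:
  fixes f :: "'a \<Rightarrow> real"
  assumes "x \<in> V"
  shows "(\<Sum>C | C \<in> S \<and> x \<in> C. \<Sum>y\<in>C. f y) =
    real (card {C \<in> S. x \<in> C}) * f x + real m * (\<Sum>y\<in>graph_sphere V E 1 x. f y)"
proof -
  let ?n = "\<lambda>y. real (card {C \<in> S. x \<in> C \<and> y \<in> C})"
  let ?N = "graph_sphere V E 1 x"
  have "(\<Sum>C | C \<in> S \<and> x \<in> C. \<Sum>y\<in>C. f y) =
      (\<Sum>C | C \<in> S \<and> x \<in> C. \<Sum>y | y \<in> V \<and> y \<in> C. f y)"
    using clique_subset_V by (intro sum.cong) auto
  also have "\<dots> = (\<Sum>y\<in>V. \<Sum>C | C \<in> {C. C \<in> S \<and> x \<in> C} \<and> y \<in> C. f y)"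
    by (rule sum.swap_restrict) auto
  also have "\<dots> = (\<Sum>y\<in>V. ?n y * f y)"
    by (simp add: conj_assoc)
  also have "\<dots> = (\<Sum>y\<in>insert x ?N. ?n y * f y)"
  proof (intro sum.mono_neutral_right ballI)
    show "insert x ?N \<subseteq> V" using assms by (auto simp: graph_sphere_def)
    fix y assume y: "y \<in> V - insert x ?N"
    then have "{x, y} \<notin> E" "x \<noteq> y" using mem_sphere_1_iff[of y x] by auto
    then have none: "{C \<in> S. x \<in> C \<and> y \<in> C} = {}" using clique by (auto simp: is_clique_def)
    show "?n y * f y = 0" by (simp only: none) simp
  qed simp
  also have "\<dots> = ?n x * f x + (\<Sum>y\<in>?N. ?n y * f y)"
    using mem_sphere_1_iff[of x x] edge_in_V[of x x] by (subst sum.insert) auto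
  also have "(\<Sum>y\<in>?N. ?n y * f y) = real m * (\<Sum>y\<in>?N. f y)"
    unfolding sum_distrib_left
  proof (intro sum.cong refl)
    fix y assume "y \<in> ?N"
    then have "{x, y} \<in> E" using mem_sphere_1_iff by blast
    from card_cliques_edge[OF this] show "?n y * f y = real m * f y" by simp
  qed
  finally show ?thesis by simp
qed

text \<open>For the constant function 1 the preceding identity reads
  \<open>r * (s + 1) = r + m * k\<close>, where \<open>r\<close> is the number sought.\<close>

lemma card_cliques_through:
  assumes "x \<in> V"
  shows "real (card {C \<in> S. x \<in> C}) = real m * (real k / real s)"
proof -
  let ?r = "real (card {C \<in> S. x \<in> C})"
  have "(\<Sum>C | C \<in> S \<and> x \<in> C. \<Sum>y\<in>C. (1::real)) = ?r * real (s + 1)"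
    using clique by simp
  then have "?r * real s = real m * real k"
    using sum_cliques_through[OF assms, of "\<lambda>_. 1"] card_sphere_1[OF assms]
    by (simp add: algebra_simps)
  then show ?thesis using s_pos by (simp add: field_simps)
qed

text \<open>Double counting gives \<open>\<Sum>\<^sub>C (\<Sum>\<^sub>x\<^sub>\<in>\<^sub>C f x)\<^sup>2 = m \<Sum>\<^sub>x f x ((A f) x + (k / s) f x)\<close>
  for the adjacency operator \<open>A\<close>, so the eigenvalue equation on the support of \<open>f\<close> suffices.\<close>

lemma clique_sums_eq_0:
  fixes f :: "'a \<Rightarrow> real"
  assumes "\<And>x. \<lbrakk>x \<in> V; f x \<noteq> 0\<rbrakk> \<Longrightarrow>
    (\<Sum>y\<in>graph_sphere V E 1 x. f y) = - (real k / real s) * f x"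
    and "C \<in> S"
  shows "(\<Sum>x\<in>C. f x) = 0"
proof -
  let ?F = "\<lambda>C. \<Sum>x\<in>C. f x"
  have "(\<Sum>C\<in>S. (?F C)\<^sup>2) = (\<Sum>C\<in>S. \<Sum>x | x \<in> V \<and> x \<in> C. f x * ?F C)"
  proof (intro sum.cong refl)
    fix C assume "C \<in> S"
    then have "{x. x \<in> V \<and> x \<in> C} = C" using clique_subset_V by auto
    then show "(?F C)\<^sup>2 = (\<Sum>x | x \<in> V \<and> x \<in> C. f x * ?F C)"
      by (simp add: power2_eq_square sum_distrib_right)
  qed
  also have "\<dots> = (\<Sum>x\<in>V. \<Sum>C | C \<in> S \<and> x \<in> C. f x * ?F C)"
    by (rule sum.swap_restrict) auto
  also have "\<dots> = 0"
  proof (rule sum.neutral, rule ballI)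
    fix x assume x: "x \<in> V"
    have "(\<Sum>C | C \<in> S \<and> x \<in> C. f x * ?F C) = f x * (\<Sum>C | C \<in> S \<and> x \<in> C. ?F C)"
      by (simp add: sum_distrib_left)
    \<comment> \<open>Off the support the factor \<open>f x\<close> vanishes; on it the two terms of
      \<open>sum_cliques_through\<close> cancel, being \<open>m * (k / s) * f x\<close> and its
      negative.\<close>
    also have "\<dots> = 0"
      using assms(1)[OF x] sum_cliques_through[OF x, of f] card_cliques_through[OF x]
      by (cases "f x = 0") (simp_all add: algebra_simps)
    finally show "(\<Sum>C | C \<in> S \<and> x \<in> C. f x * ?F C) = 0" .
  qed
  finally have "(\<Sum>C\<in>S. (?F C)\<^sup>2) = 0" .
  then have "\<forall>C\<in>S. (?F C)\<^sup>2 = 0"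
    by (subst (asm) sum_nonneg_eq_0_iff) auto
  then show ?thesis using assms(2) by simp
qed

lemma eigenvalue_equation_of_clique_sums:
  fixes f :: "'a \<Rightarrow> real"
  assumes "\<And>C. C \<in> S \<Longrightarrow> (\<Sum>x\<in>C. f x) = 0" "x \<in> V"
  shows "(\<Sum>y\<in>graph_sphere V E 1 x. f y) = - (real k / real s) * f x"
proof -
  have "real m * ((real k / real s) * f x + (\<Sum>y\<in>graph_sphere V E 1 x. f y)) = 0"
    using sum_cliques_through[OF assms(2), of f] card_cliques_through[OF assms(2)] assms(1)
    by (simp add: algebra_simps)
  then show ?thesis using m_pos by simp
qed

text \<open>An independent set meets a clique at most once, so each clique sum is a difference of
  two numbers from {0, 1} and vanishes iff they agree.\<close>

lemma bitrade_iff_clique_sums: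
  assumes "independent_vertices V E T0" "independent_vertices V E T1"
    and "T0 \<noteq> {}" "T1 \<noteq> {}" "T0 \<inter> T1 = {}"
  shows "bitrade V S T0 T1 \<longleftrightarrow> (\<forall>C\<in>S. (\<Sum>x\<in>C. bitrade_fun T0 T1 x) = 0)"
proof -
  have "(card (C \<inter> T0) = 1 \<and> card (C \<inter> T1) = 1) \<or> (C \<inter> T0 = {} \<and> C \<inter> T1 = {}) \<longleftrightarrow>
      (\<Sum>x\<in>C. bitrade_fun T0 T1 x) = 0" if C: "C \<in> S" for C
  proof -
    have fin: "finite C" using clique_subset_V[OF C] finite_V by (rule finite_subset)
    have "card (C \<inter> T) \<le> 1" if "independent_vertices V E T" for T
      using that clique[OF C] fin
      by (auto simp: card_le_Suc0_iff_eq independent_vertices_def is_clique_def) blast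
    from this[OF assms(1)] this[OF assms(2)] show ?thesis
      using fin by (auto simp: sum_bitrade_fun assms(5) le_Suc_eq)
  qed
  then show ?thesis
    using assms by (auto simp: bitrade_def independent_vertices_def)
qed

lemma bitrade_iff_eigenfunction:
  assumes "independent_vertices V E T0" "independent_vertices V E T1"
    and "T0 \<noteq> {}" "T1 \<noteq> {}" "T0 \<inter> T1 = {}"
  shows "bitrade V S T0 T1 \<longleftrightarrow>
    eigenfunction V E (- (real k / real s)) (bitrade_fun T0 T1)"
proof -
  have "\<exists>x\<in>V. bitrade_fun T0 T1 x \<noteq> 0"
    using assms by (auto simp: bitrade_fun_eq_0_iff independent_vertices_def)
  then show ?thesis
    unfolding bitrade_iff_clique_sums[OF assms] eigenfunction_def
    using clique_sums_eq_0 eigenvalue_equation_of_clique_sums by blast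
qed

end

section \<open>Weight-distribution bound, regularity and isometry for a pair of independent
  sets\<close>

locale independent_pair = dist_regular_graph + clique_system +
  fixes D :: nat and T0 T1 :: "'a set"
  assumes diameter: "graph_diameter V E = enat D"
    and independent: "independent_vertices V E T0" "independent_vertices V E T1"
    and nonempty: "T0 \<noteq> {}" "T1 \<noteq> {}" and disjoint: "T0 \<inter> T1 = {}"
begin

abbreviation "\<theta> \<equiv> - (real k / real s)"
abbreviation "f \<equiv> bitrade_fun T0 T1"
abbreviation "T \<equiv> T0 \<union> T1"
abbreviation "F \<equiv> induced_edges E T"

lemma T_subset_V: "T0 \<subseteq> V" "T1 \<subseteq> V"
  using independent by (auto simp: independent_vertices_def)

lemma edge_in_T:
  assumes "{x, y} \<in> E" "x \<in> T" "y \<in> T"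
  shows "f y = - f x"
  using assms independent disjoint
  by (auto simp: bitrade_fun_def independent_vertices_def)

text \<open>For a vertex \<open>x\<close> of \<open>T\<close> the sphere of radius \<open>i\<close> around \<open>x\<close> contains at least
  \<open>\<bar>W\<^sup>i\<bar>\<close> elements of \<open>T\<close>, with equality iff \<open>f\<close> does not change sign there.\<close>

lemma meets_wd_bound_iff:
  assumes "eigenfunction V E \<theta> f" "x \<in> T"
  shows "meets_wd_bound V D k b c \<theta> f \<longleftrightarrow>
    (\<forall>i\<le>D. graph_sphere V E i x \<inter> T0 = {} \<or> graph_sphere V E i x \<inter> T1 = {})"
proof -
  let ?p = "\<lambda>i. real (card (graph_sphere V E i x \<inter> T0))"
  let ?q = "\<lambda>i. real (card (graph_sphere V E i x \<inter> T1))"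
  have x: "x \<in> V" using assms(2) T_subset_V by blast
  have "{y \<in> V. f y \<noteq> 0} = V \<inter> {y. y \<in> T0 \<or> y \<in> T1}"
    by (auto simp: bitrade_fun_eq_0_iff)
  then have "real (card {y \<in> V. f y \<noteq> 0}) = (\<Sum>y\<in>V. if y \<in> T then 1 else 0)"
    by (simp add: sum.If_cases)
  also have "\<dots> = (\<Sum>i=0..D. \<Sum>y\<in>graph_sphere V E i x. if y \<in> T then 1 else 0)"
    by (rule sum_spheres[OF x diameter, symmetric])
  also have "\<dots> = (\<Sum>i=0..D. ?p i + ?q i)"
  proof (intro sum.cong refl)
    fix i
    have "card (graph_sphere V E i x \<inter> T) =
        card (graph_sphere V E i x \<inter> T0) + card (graph_sphere V E i x \<inter> T1)"
      unfolding Int_Un_distrib using disjoint by (intro card_Un_disjoint) auto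
    then show "(\<Sum>y\<in>graph_sphere V E i x. if y \<in> T then 1 else 0) = ?p i + ?q i"
      by (simp add: sum.If_cases Un_def)
  qed
  finally have card: "real (card {y \<in> V. f y \<noteq> 0}) = (\<Sum>i=0..D. ?p i + ?q i)" .
  have "\<bar>wd_coeff k b c \<theta> i\<bar> = \<bar>?p i - ?q i\<bar>" if "i \<le> D" for i
  proof -
    \<comment> \<open>Choosing the centre in \<open>T\<close> lets the factor \<open>f x\<close> of
      the sphere sum drop out of absolute values.\<close>
    have "\<bar>f x\<bar> = 1" using assms(2) by (auto simp: bitrade_fun_def)
    then have "\<bar>wd_coeff k b c \<theta> i\<bar> = \<bar>wd_coeff k b c \<theta> i * f x\<bar>" by (simp add: abs_mult)
    then show ?thesis
      using sphere_sum[OF assms(1) x diameter that] by (simp add: sum_bitrade_fun disjoint)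
  qed
  \<comment> \<open>Each summand is twice the minimum of the two counts: nonnegative, and zero iff
    one of the counts is zero.\<close>
  then have "meets_wd_bound V D k b c \<theta> f \<longleftrightarrow> (\<Sum>i=0..D. ?p i + ?q i - \<bar>?p i - ?q i\<bar>) = 0"
    unfolding meets_wd_bound_def card sum_subtractf by simp
  also have "\<dots> \<longleftrightarrow> (\<forall>i\<in>{0..D}. ?p i + ?q i - \<bar>?p i - ?q i\<bar> = 0)"
    by (intro sum_nonneg_eq_0_iff) auto
  also have "\<dots> \<longleftrightarrow> (\<forall>i\<le>D. ?p i = 0 \<or> ?q i = 0)"
  proof -
    have "p + q - \<bar>p - q\<bar> = 0 \<longleftrightarrow> p = 0 \<or> q = 0" if "p \<ge> 0" "q \<ge> 0" for p q :: real
      using that by linarith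
    then show ?thesis by (simp add: Ball_def del: of_nat_eq_0_iff)
  qed
  finally show ?thesis by simp
qed

text \<open>By independence all neighbours of \<open>x\<close> inside \<open>T\<close> carry the
  sign opposite to \<open>x\<close>, so the neighbour sum of \<open>f\<close> is
  \<open>- f x\<close> times the degree of \<open>x\<close> in the induced subgraph.\<close>

lemma regular_iff:
  "regular_graph T F (real k / real s) \<longleftrightarrow>
    (\<forall>x\<in>T. (\<Sum>y\<in>graph_sphere V E 1 x. f y) = \<theta> * f x)"
proof -
  have "real (card {y \<in> T. {x, y} \<in> F}) = real k / real s \<longleftrightarrow>
      (\<Sum>y\<in>graph_sphere V E 1 x. f y) = \<theta> * f x" if x: "x \<in> T" for x
  proof -
    let ?N = "graph_sphere V E 1 x"
    have N: "{y \<in> T. {x, y} \<in> F} = ?N \<inter> T"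
      using x mem_sphere_1_iff[of _ x] by (auto simp: induced_edges_def)
    show ?thesis
    proof (cases "x \<in> T0")
      case True
      then have "?N \<inter> T0 = {}"
        using independent mem_sphere_1_iff[of _ x] by (auto simp: independent_vertices_def)
      moreover have "f x = 1" using True by (simp add: bitrade_fun_def)
      ultimately show ?thesis
        unfolding N Int_Un_distrib sum_bitrade_fun[OF finite_sphere disjoint] by simp
    next
      case False
      with x have "x \<in> T1" by simp
      then have "?N \<inter> T1 = {}"
        using independent mem_sphere_1_iff[of _ x] by (auto simp: independent_vertices_def)
      moreover have "f x = -1" using False \<open>x \<in> T1\<close> by (simp add: bitrade_fun_def)
      ultimately show ?thesis
        unfolding N Int_Un_distrib sum_bitrade_fun[OF finite_sphere disjoint] by simp
    qed
  qed
  then show ?thesis by (simp add: regular_graph_def)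
qed

text \<open>A clique through the last edge of a geodesic from \<open>x\<close> to \<open>y\<close> contains a vertex \<open>z\<close> of \<open>T\<close>
  of sign opposite to \<open>y\<close>; as signs are constant on the spheres around \<open>x\<close>, it is closer to \<open>x\<close>
  than \<open>y\<close>.\<close>

lemma isometric_if_meets_wd_bound:
  assumes eig: "eigenfunction V E \<theta> f" and meets: "meets_wd_bound V D k b c \<theta> f"
  shows "isometric_subgraph E T F"
proof -
  have bitrade: "bitrade V S T0 T1"
    using eig bitrade_iff_eigenfunction independent nonempty disjoint by blast
  \<comment> \<open>Distances cannot shrink in a subgraph, so it is enough to find a walk inside
    \<open>T\<close> whose length is the distance in the whole graph.\<close>
  have walk: "(x, y) \<in> adjacency F ^^ n"
    if "x \<in> T" "y \<in> T" "graph_dist E x y = enat n" for x y n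
    using that
  proof (induction n arbitrary: y)
    case 0
    then show ?case by (simp flip: zero_enat_def)
  next
    case (Suc n)
    have xy: "x \<in> V" "y \<in> V" using Suc.prems T_subset_V by auto
    obtain w where w: "graph_dist E x w = enat n" "{w, y} \<in> E"
      using graph_dist_pred[OF Suc.prems(3)] .
    have "{C \<in> S. {w, y} \<subseteq> C} \<noteq> {}"
      using card_cliques_edge[OF w(2)] m_pos by (metis card.empty less_irrefl)
    then obtain C where C: "C \<in> S" "w \<in> C" "y \<in> C" by auto
    have "(card (C \<inter> T0) = 1 \<and> card (C \<inter> T1) = 1) \<or> (C \<inter> T0 = {} \<and> C \<inter> T1 = {})"
      using bitrade C(1) by (simp add: bitrade_def)
    then have "C \<inter> T0 \<noteq> {} \<and> C \<inter> T1 \<noteq> {}"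
      using C(3) Suc.prems(2) by auto
    then obtain z where z: "z \<in> C" "z \<in> T0 \<and> y \<in> T1 \<or> z \<in> T1 \<and> y \<in> T0"
      using Suc.prems(2) by blast
    then have zT: "z \<in> T" "z \<noteq> y" "z \<in> V" using disjoint T_subset_V by auto
    have zy: "{z, y} \<in> E" using clique[OF C(1)] z(1) C(3) zT(2) by (simp add: is_clique_def)
    \<comment> \<open>Both \<open>z\<close> and \<open>w\<close> lie in \<open>C\<close>, so they
      are equal or adjacent. As \<open>z\<close> is also adjacent to \<open>y\<close>, its distance
      from \<open>x\<close> can only be \<open>n\<close> or \<open>n + 1\<close>.\<close>
    have "graph_dist E x z \<le> enat (Suc n)"
    proof (cases "z = w")
      case False
      then have "{w, z} \<in> E" using clique[OF C(1)] z(1) C(2) by (simp add: is_clique_def)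
      then show ?thesis by (rule graph_dist_step[OF _ w(1)])
    qed (use w(1) in simp)
    then obtain j where j: "graph_dist E x z = enat j" "j \<le> Suc n"
      by (cases "graph_dist E x z") auto
    have "Suc n \<le> Suc j" using graph_dist_step[OF zy j(1)] Suc.prems(3) by simp
    moreover have "j \<noteq> Suc n"
    proof
      assume "j = Suc n"
      then have "z \<in> graph_sphere V E (Suc n) x" "y \<in> graph_sphere V E (Suc n) x"
        using j(1) zT(3) xy Suc.prems(3) by (auto simp: graph_sphere_def)
      moreover have "Suc n \<le> D"
        using graph_dist_le_diameter[OF xy] Suc.prems(3) diameter by simp
      ultimately show False
        using meets_wd_bound_iff[OF eig Suc.prems(1)] meets z(2) by blast
    qed
    ultimately have "graph_dist E x z = enat n" using j by simp
    then have "(x, z) \<in> adjacency F ^^ n" using Suc.IH Suc.prems(1) zT(1) by blast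
    moreover have "(z, y) \<in> adjacency F"
      using zy zT(1) Suc.prems(2) by (simp add: adjacency_def induced_edges_def)
    ultimately show ?case by auto
  qed
  show ?thesis
    unfolding isometric_subgraph_def
  proof (intro ballI antisym)
    fix x y assume xy: "x \<in> T" "y \<in> T"
    show "graph_dist E x y \<le> graph_dist F x y"
      by (rule graph_dist_antimono) (auto simp: induced_edges_def)
    obtain n where n: "graph_dist E x y = enat n"
      using finite_dist[of x y] xy T_subset_V by blast
    then show "graph_dist F x y \<le> graph_dist E x y"
      using walk[OF xy n] by (simp add: graph_dist_le)
  qed
qed

text \<open>The induced subgraph is bipartite with parts \<open>T0\<close> and \<open>T1\<close>:
  every edge reverses the sign.\<close>

lemma bitrade_fun_walk:
  "(x, y) \<in> adjacency F ^^ n \<Longrightarrow> f y = (-1) ^ n * f x"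
proof (induction n arbitrary: y)
  case (Suc n)
  then obtain z where z: "(x, z) \<in> adjacency F ^^ n" "(z, y) \<in> adjacency F"
    by (auto elim: relpow_Suc_E)
  then have "f y = - f z"
    by (intro edge_in_T) (auto simp: adjacency_def induced_edges_def)
  then show ?case using Suc.IH[OF z(1)] by simp
qed simp

text \<open>Regularity yields the eigenvalue equation only on \<open>T\<close>. This is the support
  of \<open>f\<close>, so all clique sums vanish, and these in turn give the equation on all of
  \<open>V\<close>.\<close>

lemma eigenfunction_if_regular:
  assumes "regular_graph T F (real k / real s)"
  shows "eigenfunction V E \<theta> f"
proof -
  have "(\<Sum>x\<in>C. f x) = 0" if "C \<in> S" for C
    using assms that by (intro clique_sums_eq_0) (auto simp: regular_iff bitrade_fun_eq_0_iff)
  then have "bitrade V S T0 T1"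
    using bitrade_iff_clique_sums independent nonempty disjoint by blast
  then show ?thesis
    using bitrade_iff_eigenfunction independent nonempty disjoint by blast
qed

text \<open>A vertex of \<open>T\<close> at distance \<open>i\<close> from \<open>x\<close> ends a
  walk of length \<open>i\<close> inside \<open>T\<close>, so its sign depends only on
  \<open>i\<close>. A single centre \<open>x\<close> suffices, as \<open>meets_wd_bound_iff\<close>
  may be used at any vertex of \<open>T\<close>.\<close>

lemma meets_wd_bound_if_isometric:
  assumes "eigenfunction V E \<theta> f" and iso: "isometric_subgraph E T F"
  shows "meets_wd_bound V D k b c \<theta> f"
proof -
  obtain x where x: "x \<in> T" using nonempty by blast
  have "f y = (-1) ^ i * f x" if "y \<in> graph_sphere V E i x" "y \<in> T" for y i
    using that x iso
    by (intro bitrade_fun_walk walk_of_graph_dist) (simp add: isometric_subgraph_def graph_sphere_def)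
  then have "f y = f z"
    if "y \<in> graph_sphere V E i x \<inter> T0" "z \<in> graph_sphere V E i x \<inter> T1" for y z i
    using that by (metis IntE UnI1 UnI2)
  moreover have "f y \<noteq> f z" if "y \<in> T0" "z \<in> T1" for y z
    using that disjoint by (auto simp: bitrade_fun_def)
  ultimately show ?thesis
    unfolding meets_wd_bound_iff[OF assms(1) x] by (metis IntE ex_in_conv)
qed

end

section \<open>Equivalence of the three conditions\<close>

theorem theorem3:
  fixes V :: "'a set" and E :: "'a set set" and S :: "'a set set" and T0 T1 :: "'a set"
    and b c :: "nat \<Rightarrow> nat" and k s m D :: nat
  assumes "distance_regular V E b c"
    and "regular_graph V E (real k)"
    and "graph_diameter V E = enat D"
    and "\<forall>C\<in>S. is_clique V E C \<and> card C = s + 1"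
    and "\<forall>e\<in>E. card {C \<in> S. e \<subseteq> C} = m"
    and "m \<ge> 1"
    and "independent_vertices V E T0" and "independent_vertices V E T1"
    and "T0 \<noteq> {}" and "T1 \<noteq> {}" and "T0 \<inter> T1 = {}"
  defines "\<theta> \<equiv> - (real k / real s)"
    and "f \<equiv> bitrade_fun T0 T1"
    and "T \<equiv> T0 \<union> T1"
  shows "(bitrade V S T0 T1 \<and> meets_wd_bound V D k b c \<theta> f \<longleftrightarrow>
          eigenfunction V E \<theta> f \<and> meets_wd_bound V D k b c \<theta> f) \<and>
         (eigenfunction V E \<theta> f \<and> meets_wd_bound V D k b c \<theta> f \<longleftrightarrow>
          regular_graph T (induced_edges E T) (real k / real s) \<and>
          isometric_subgraph E T (induced_edges E T))"
proof -
  obtain x y where xy: "x \<in> T0" "y \<in> T1" using assms(9,10) by blast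
  then have V: "x \<in> V" "y \<in> V" and "x \<noteq> y"
    using assms(7,8,11) by (auto simp: independent_vertices_def)
  interpret dist_regular_graph V E k b c
    using assms(1,2) by unfold_locales (auto simp: distance_regular_def)
  \<comment> \<open>Two distinct vertices in a connected graph force an edge, which lies in some
    clique because \<open>m \<ge> 1\<close>; that clique would be a single vertex if
    \<open>s = 0\<close>.\<close>
  have "s > 0"
  proof (rule ccontr)
    assume "\<not> s > 0"
    obtain n where n: "graph_dist E x y = enat n" using finite_dist[OF V] .
    with \<open>x \<noteq> y\<close> obtain n' where "n = Suc n'"
      by (cases n) (auto simp flip: zero_enat_def)
    then obtain z where z: "{z, y} \<in> E" using graph_dist_pred n by metis
    then have "card {C \<in> S. {z, y} \<subseteq> C} > 0" using assms(5,6) by auto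
    then obtain C where C: "C \<in> S" "{z, y} \<subseteq> C"
      by (metis (no_types, lifting) Collect_empty_eq card.empty less_irrefl)
    then have "card C = 1" using assms(4) \<open>\<not> s > 0\<close> by simp
    then show False using C(2) edge_in_V[OF z] by (auto simp: card_1_singleton_iff)
  qed
  interpret independent_pair V E k b c S s m D T0 T1
    using assms \<open>s > 0\<close> by unfold_locales auto
  show ?thesis
    unfolding \<theta>_def f_def T_def
    \<comment> \<open>Regularity follows from the eigenvalue equation by restricting it from
      \<open>V\<close> to \<open>T\<close>.\<close>
    using bitrade_iff_eigenfunction[OF independent nonempty disjoint] regular_iff
      eigenfunction_if_regular isometric_if_meets_wd_bound meets_wd_bound_if_isometric
      T_subset_V
    by (auto simp: eigenfunction_def)
qed

end
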